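(* Let $(X,\mathcal{A},\mathbf{P})$ be a probability space, let $p_0>1$ and $\Delta\ge0$ be constants, and let $S:[1,\infty)\to(0,\infty)$ be continuous and slowly varying at infinity. Then $$ L(\Phi_{p_0,\Delta,S})\ \subset\ wL\Phi_{p_0,\Delta,S}\ \subset\ G\psi_{p_0,\Delta,S}, $$ where $\subset$ denotes linear continuous embedding.
   Context: Define the even function $\Phi_{p_0,\Delta,S}$ by $$ \Phi_{p_0,\Delta,S}(u)=\frac{|u|^{p_0}(\log|u|)^{-\Delta}}{S(\log|u|)},\quad |u|\ge e;\qquad \Phi_{p_0,\Delta,S}(u)=C_0\,u^2,\quad |u|\le e, $$ where the constant $C_0>0$ is determined by continuity at $|u|=e$: $C_0e^2=e^{p_0}/S(1)$. For $1\le p<p_0$ put $$ \psi_{p_0,\Delta,S}(p)=(p_0-p)^{-(1+\Delta)/p_0}\,S^{1/p_0}\!\left(\frac{p_0}{p_0-p}\right). $$ For measurable $f:X\to\mathbb{R}$ let $T_f(t)=\mathbf{P}\{x:|f(x)|\ge t\}$ and $\|f\|_p=\left(\int_X|f|^p\,d\mathbf{P}\right)^{1/p}$. For $\Phi=\Phi_{p_0,\Delta,S}$ and $\psi=\psi_{p_0,\Delta,S}$ set - $\|f\|_{L(\Phi)}=\inf\{u>0:\int_X\Phi(|f(x)|/u)\,\mathbf{P}(dx)\le1\}$, and $L(\Phi)=\{f:\|f\|_{L(\Phi)}<\infty\}$ (Orlicz space); - $\|f\|_{wL\Phi}=\inf\{c>0:\sup_{t>0}[\Phi(t/c)T_f(t)]\le1\}$,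 and $wL\Phi=\{f:\|f\|_{wL\Phi}<\infty\}$ (weak Orlicz space); - $\|f\|_{G\psi}=\sup_{1\le p<p_0}\|f\|_p/\psi(p)$, and $G\psi=\{f:\|f\|_{G\psi}<\infty\}$ (Grand Lebesgue space). Continuous embedding $Y\subset Z$ of two such spaces means that there is a constant $C<\infty$ with $\|f\|_Z\le C\|f\|_Y$ for all $f\in Y$. *)

theory Defs
  imports "HOL-Probability.Probability"
begin

definition slowly_varying :: "(real \<Rightarrow> real) \<Rightarrow> bool" where
  "slowly_varying S \<longleftrightarrow> (\<forall>a>0. ((\<lambda>x. S (a * x) / S x) \<longlongrightarrow> 1) at_top)"

text \<open>\<open>S\<close> is a total function, but only its values on \<open>[1, \<infinity>)\<close> enter the two definitions below
  (for \<^term>\<open>p\<close> in \<open>[1, p0)\<close> in the case of \<open>psi_fun\<close>).  The coefficient in the second branch of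
  \<open>Phi_fun\<close> is the constant \<open>C\<^sub>0\<close> with \<open>C\<^sub>0 e\<^sup>2 = e\<^bsup>p0\<^esup> / S 1\<close>.\<close>

definition Phi_fun :: "real \<Rightarrow> real \<Rightarrow> (real \<Rightarrow> real) \<Rightarrow> real \<Rightarrow> real" where
  "Phi_fun p0 \<Delta> S u =
    (if \<bar>u\<bar> \<ge> exp 1 then \<bar>u\<bar> powr p0 * (ln \<bar>u\<bar>) powr (- \<Delta>) / S (ln \<bar>u\<bar>)
     else (exp p0 / S 1 / (exp 1)\<^sup>2) * u\<^sup>2)"

definition psi_fun :: "real \<Rightarrow> real \<Rightarrow> (real \<Rightarrow> real) \<Rightarrow> real \<Rightarrow> real" where
  "psi_fun p0 \<Delta> S p =
    (p0 - p) powr (- (1 + \<Delta>) / p0) * S (p0 / (p0 - p)) powr (1 / p0)"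

definition tail_fun :: "'a measure \<Rightarrow> ('a \<Rightarrow> real) \<Rightarrow> real \<Rightarrow> real" where
  "tail_fun M f t = measure M {x \<in> space M. \<bar>f x\<bar> \<ge> t}"

text \<open>All (quasi-)norms take values in \<^typ>\<open>ennreal\<close>, so that they are defined for every measurable
  function; in particular the infimum of the empty set is \<open>\<infinity>\<close>.\<close>

definition Lp_norm :: "'a measure \<Rightarrow> real \<Rightarrow> ('a \<Rightarrow> real) \<Rightarrow> ennreal" where
  "Lp_norm M p f =
    (let I = \<integral>\<^sup>+ x. ennreal (\<bar>f x\<bar> powr p) \<partial>M
     in if I = \<top> then \<top> else ennreal (enn2real I powr (1 / p)))"

definition Orlicz_norm :: "'a measure \<Rightarrow> (real \<Rightarrow> real) \<Rightarrow> ('a \<Rightarrow> real) \<Rightarrow> ennreal" where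
  "Orlicz_norm M \<Phi> f =
    (INF u \<in> {u. u > 0 \<and> (\<integral>\<^sup>+ x. ennreal (\<Phi> (\<bar>f x\<bar> / u)) \<partial>M) \<le> 1}. ennreal u)"

definition weak_Orlicz_norm :: "'a measure \<Rightarrow> (real \<Rightarrow> real) \<Rightarrow> ('a \<Rightarrow> real) \<Rightarrow> ennreal" where
  "weak_Orlicz_norm M \<Phi> f =
    (INF c \<in> {c. c > 0 \<and> (SUP t \<in> {0<..}. ennreal (\<Phi> (t / c) * tail_fun M f t)) \<le> 1}. ennreal c)"

definition grand_Lebesgue_norm ::
    "'a measure \<Rightarrow> real \<Rightarrow> (real \<Rightarrow> real) \<Rightarrow> ('a \<Rightarrow> real) \<Rightarrow> ennreal" where
  "grand_Lebesgue_norm M p0 \<psi> f = (SUP p \<in> {1..<p0}. Lp_norm M p f / ennreal (\<psi> p))"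

definition fun_space :: "'a measure \<Rightarrow> (('a \<Rightarrow> real) \<Rightarrow> ennreal) \<Rightarrow> ('a \<Rightarrow> real) set" where
  "fun_space M N = {f \<in> borel_measurable M. N f < \<top>}"

definition continuously_embedded ::
    "'a measure \<Rightarrow> (('a \<Rightarrow> real) \<Rightarrow> ennreal) \<Rightarrow> (('a \<Rightarrow> real) \<Rightarrow> ennreal) \<Rightarrow> bool" where
  "continuously_embedded M N1 N2 \<longleftrightarrow>
    fun_space M N1 \<subseteq> fun_space M N2 \<and>
    (\<exists>C::real. C \<ge> 0 \<and> (\<forall>f \<in> fun_space M N1. N2 f \<le> ennreal C * N1 f))"

end

theory Submission
  imports Defs
begin

text \<open>By the Baire category theorem, the increments \<open>h (u + v) - h u\<close> of
  \<open>h = ln \<circ> S \<circ> exp\<close> are bounded uniformly for small \<open>v\<close>, and chaining them gives Potter's bounds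
  for \<open>S\<close>.  These show that \<open>\<Phi> t / t\<close> is increasing up to a constant factor, so the first embedding
  is Chebyshev's inequality.  For the second, summing the tail over the levels \<open>e\<^sup>k\<close> bounds the
  \<open>p\<close>-th moment by a constant times \<open>\<Sum>k. exp (- (p0 - p) k) k\<^sup>\<Delta> S k\<close>, which is of order
  \<open>(p0 - p)\<close> to the power \<open>- (1 + \<Delta>)\<close> times \<open>S (p0 / (p0 - p))\<close>.\<close>

section \<open>Potter bounds for slowly varying functions\<close>

text \<open>The hypothesis is only pointwise in the shift. Shifts are sorted by a threshold beyond
  which their increments stay within 1; some class contains a ball, and two increments taken from
  one base point differ by an increment over a short shift, which is where the bound 2 comes
  from.\<close>

lemma shift_increment_bound:
  fixes h :: "real \<Rightarrow> real"
  assumes cont: "continuous_on UNIV h"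
    and lim: "\<And>v. ((\<lambda>u. h (u + v) - h u) \<longlongrightarrow> 0) at_top"
  shows "\<exists>N \<beta>. \<beta> > 0 \<and> (\<forall>u\<ge>N. \<forall>t\<in>{0..\<beta>}. \<bar>h (u + t) - h u\<bar> \<le> 2)"
proof -
  define E where "E n = {v. \<forall>u\<ge>real n. \<bar>h (u + v) - h u\<bar> \<le> 1}" for n :: nat
  have closedE: "closed (E n)" for n
  proof -
    have "E n = (\<Inter>u\<in>{real n..}. {v. \<bar>h (u + v) - h u\<bar> \<le> 1})"
      by (auto simp: E_def)
    moreover have "closed {v. \<bar>h (u + v) - h u\<bar> \<le> 1}" for u
      by (intro closed_Collect_le continuous_intros continuous_on_compose2[OF cont]) auto
    ultimately show ?thesis by (simp add: closed_INT)
  qed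
  have cover: "(\<Union>n. E n) = UNIV"
  proof -
    have "\<exists>n. v \<in> E n" for v
    proof -
      have "eventually (\<lambda>u. dist (h (u + v) - h u) 0 < 1) at_top"
        using lim[of v] by (rule tendstoD) simp
      then obtain N where N: "\<And>u. u \<ge> N \<Longrightarrow> \<bar>h (u + v) - h u\<bar> < 1"
        by (auto simp: eventually_at_top_linorder dist_real_def)
      obtain n :: nat where "N \<le> real n" using real_arch_simple by blast
      then have "v \<in> E n" using N by (force simp: E_def intro: less_imp_le)
      then show ?thesis ..
    qed
    then show ?thesis by blast
  qed
  \<comment> \<open>Otherwise the complements of the \<open>E n\<close> would be open and dense, and
    by Baire their intersection would be dense, although it is empty.\<close>
  have "\<exists>n. interior (E n) \<noteq> {}"
  proof (rule ccontr)
    assume "\<not> ?thesis"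
    then have "closure (- E n) = UNIV" for n
      by (simp add: closure_complement)
    then have "UNIV \<subseteq> closure (\<Inter>n. - E n)"
      by (intro Baire) (use closedE in \<open>auto simp: open_Compl\<close>)
    moreover have "(\<Inter>n. - E n) = {}" using cover by blast
    ultimately show False by simp
  qed
  then obtain n a where "a \<in> interior (E n)" by blast
  then obtain r where r: "r > 0" "cball a r \<subseteq> E n"
    by (meson mem_interior_cball)
  show ?thesis
  proof (intro exI conjI ballI allI impI)
    show "r > 0" by fact
    fix u t assume u: "u \<ge> real n + a" and t: "t \<in> {0..r}"
    have "a \<in> E n" "a + t \<in> E n" using r t by (auto simp: dist_real_def subset_eq)
    \<comment> \<open>The base point \<open>u - a\<close> lies beyond the threshold
      \<open>n\<close>, so both shifts \<open>a\<close> and \<open>a + t\<close> may be applied to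
      it.\<close>
    then have "\<bar>h ((u - a) + a) - h (u - a)\<bar> \<le> 1 \<and> \<bar>h ((u - a) + (a + t)) - h (u - a)\<bar> \<le> 1"
      using u unfolding E_def by (smt (verit, best) mem_Collect_eq)
    then have "\<bar>h u - h (u - a)\<bar> \<le> 1" "\<bar>h (u + t) - h (u - a)\<bar> \<le> 1" by simp_all
    then show "\<bar>h (u + t) - h u\<bar> \<le> 2" by linarith
  qed
qed

text \<open>Far out, unit increments are below \<delta>, so the integer part of \<open>w - u\<close>
  costs at most \<delta> per unit. The fractional part costs a constant by chaining short shifts,
  and the remaining compact initial interval costs another constant.\<close>

lemma additive_potter_bound:
  fixes h :: "real \<Rightarrow> real"
  assumes cont: "continuous_on UNIV h"
    and lim: "\<And>v. ((\<lambda>u. h (u + v) - h u) \<longlongrightarrow> 0) at_top"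
    and "\<delta> > 0"
  shows "\<exists>A\<ge>0. \<forall>u\<ge>0. \<forall>w\<ge>0. \<bar>h w - h u\<bar> \<le> A + \<delta> * \<bar>w - u\<bar>"
proof -
  obtain N \<beta> where \<beta>: "\<beta> > 0" and N: "\<And>u t. u \<ge> N \<Longrightarrow> t \<in> {0..\<beta>} \<Longrightarrow> \<bar>h (u + t) - h u\<bar> \<le> 2"
    using shift_increment_bound[OF cont lim] by blast
  have chain: "\<bar>h (u + t) - h u\<bar> \<le> 2 * real k"
    if "u \<ge> N" "0 \<le> t" "t \<le> real k * \<beta>" for u t k
    using that
  proof (induction k arbitrary: t)
    case (Suc k)
    show ?case
    proof (cases "t \<le> \<beta>")
      case True
      then show ?thesis using N[of u t] Suc.prems by auto
    next
      case False
      have "\<bar>h (u + (t - \<beta>)) - h u\<bar> \<le> 2 * real k"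
        by (rule Suc.IH) (use Suc.prems False in \<open>auto simp: algebra_simps\<close>)
      moreover have "\<bar>h ((u + (t - \<beta>)) + \<beta>) - h (u + (t - \<beta>))\<bar> \<le> 2"
        by (rule N) (use \<beta> Suc.prems False in auto)
      ultimately show ?thesis by (simp add: algebra_simps)
    qed
  qed simp
  \<comment> \<open>With this many steps of length \<beta>, every shift of length at most 1 is
    reached.\<close>
  obtain k :: nat where "1 / \<beta> \<le> real k" using real_arch_simple by blast
  then have k: "1 \<le> real k * \<beta>" using \<beta> by (simp add: field_simps)
  define M where "M = 2 * real k"
  have M: "\<bar>h (u + t) - h u\<bar> \<le> M" if "u \<ge> N" "0 \<le> t" "t \<le> 1" for u t
    unfolding M_def using chain[of u t k] that k by simp
  have "eventually (\<lambda>u. dist (h (u + 1) - h u) 0 < \<delta>) at_top"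
    using lim[of 1] \<open>\<delta> > 0\<close> by (rule tendstoD)
  then obtain N' where N': "\<And>u. u \<ge> N' \<Longrightarrow> \<bar>h (u + 1) - h u\<bar> < \<delta>"
    by (auto simp: eventually_at_top_linorder dist_real_def)
  have steps: "\<bar>h (u + real n) - h u\<bar> \<le> \<delta> * real n" if "u \<ge> N'" for u n
  proof (induction n)
    case (Suc n)
    have "\<bar>h ((u + real n) + 1) - h (u + real n)\<bar> < \<delta>" by (rule N') (use that in simp)
    then show ?case using Suc.IH by (simp add: algebra_simps)
  qed simp
  define U where "U = max 0 (max N N')"
  have far: "\<bar>h w - h u\<bar> \<le> M + \<delta> * (w - u)" if "U \<le> u" "u \<le> w" for u w
  proof -
    define n where "n = nat \<lfloor>w - u\<rfloor>"
    have n: "real n \<le> w - u" "w - u \<le> real n + 1" using that by (auto simp: n_def)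
    have "\<bar>h (u + real n) - h u\<bar> \<le> \<delta> * real n" using that by (intro steps) (auto simp: U_def)
    also have "\<dots> \<le> \<delta> * (w - u)" using n \<open>\<delta> > 0\<close> by simp
    finally have "\<bar>h (u + real n) - h u\<bar> \<le> \<delta> * (w - u)" .
    moreover have "\<bar>h ((u + real n) + (w - u - real n)) - h (u + real n)\<bar> \<le> M"
      by (rule M) (use that n in \<open>auto simp: U_def\<close>)
    ultimately show ?thesis by simp
  qed
  have "compact (h ` {0..U})"
    by (intro compact_continuous_image continuous_on_subset[OF cont]) auto
  then obtain B where B: "\<And>u. u \<in> {0..U} \<Longrightarrow> \<bar>h u\<bar> \<le> B"
    using compact_imp_bounded bounded_iff by (metis image_eqI real_norm_def)
  have U0: "U \<ge> 0" by (simp add: U_def)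
  have B0: "B \<ge> 0" using B[of 0] U0 by simp
  have M0: "M \<ge> 0" by (simp add: M_def)
  \<comment> \<open>Below \<open>U\<close> both values are bounded by \<open>B\<close>; a pair on
    either side of \<open>U\<close> is compared through \<open>h U\<close>. Either way
    \<open>2 * B\<close> pays for the initial interval.\<close>
  have ordered: "\<bar>h w - h u\<bar> \<le> (M + 2 * B) + \<delta> * (w - u)" if "0 \<le> u" "u \<le> w" for u w
  proof (cases "U \<le> u")
    case True
    then show ?thesis using far[of u w] that B0 by simp
  next
    case uU: False
    show ?thesis
    proof (cases "w \<le> U")
      case True
      have "\<bar>h w\<bar> \<le> B" "\<bar>h u\<bar> \<le> B" using B that True uU by auto
      moreover have "0 \<le> \<delta> * (w - u)" using that \<open>\<delta> > 0\<close> by simp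
      ultimately show ?thesis using M0 by linarith
    next
      case False
      have "\<bar>h U\<bar> \<le> B" "\<bar>h u\<bar> \<le> B" using B that uU U0 by auto
      moreover have "\<bar>h w - h U\<bar> \<le> M + \<delta> * (w - U)" using far False by simp
      moreover have "\<delta> * (w - U) \<le> \<delta> * (w - u)" using uU \<open>\<delta> > 0\<close> by simp
      ultimately show ?thesis by linarith
    qed
  qed
  have "\<bar>h w - h u\<bar> \<le> (M + 2 * B) + \<delta> * \<bar>w - u\<bar>" if "u \<ge> 0" "w \<ge> 0" for u w
    using ordered[of u w] ordered[of w u] that by (cases "u \<le> w") (auto simp: abs_minus_commute)
  then show ?thesis using M0 B0 by (intro exI[of _ "M + 2 * B"]) auto
qed

text \<open>In the coordinate \<open>u = ln x\<close>, slow variation says that increments of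
  \<open>h\<close> vanish at infinity; exponentiating the additive bound gives the multiplicative
  one.\<close>

lemma potter_bound:
  assumes pos: "\<And>x. x \<ge> 1 \<Longrightarrow> S x > 0" and cont: "continuous_on {1..} S"
    and sv: "slowly_varying S" and "\<delta> > 0"
  shows "\<exists>A\<ge>1. \<forall>x\<ge>1. \<forall>y\<ge>1. S y \<le> A * max (y / x) (x / y) powr \<delta> * S x"
proof -
  \<comment> \<open>The clamp \<open>max 0 u\<close> keeps the argument of \<open>S\<close> in the
    region where it is positive and continuous, so that \<open>h\<close> is continuous on the whole
    line, as the Baire argument requires.\<close>
  define h where "h u = ln (S (exp (max 0 u)))" for u
  have conth: "continuous_on UNIV h"
    unfolding h_def
    by (intro continuous_on_ln continuous_on_compose2[OF cont] continuous_intros)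
      (auto intro!: pos less_imp_neq[symmetric])
  have limh: "((\<lambda>u. h (u + v) - h u) \<longlongrightarrow> 0) at_top" for v
  proof -
    have "((\<lambda>x. S (exp v * x) / S x) \<longlongrightarrow> 1) at_top" using sv by (simp add: slowly_varying_def)
    then have "((\<lambda>u. S (exp v * exp u) / S (exp u)) \<longlongrightarrow> 1) at_top"
      by (rule filterlim_compose) (rule exp_at_top)
    then have "((\<lambda>u. ln (S (exp v * exp u) / S (exp u))) \<longlongrightarrow> ln 1) at_top"
      by (rule tendsto_ln) simp
    \<comment> \<open>From \<open>max 0 (- v)\<close> on, both clamps are inactive.\<close>
    moreover have "eventually (\<lambda>u. ln (S (exp v * exp u) / S (exp u)) = h (u + v) - h u) at_top"
      using eventually_ge_at_top[of "max 0 (- v)"]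
    proof eventually_elim
      case (elim u)
      have "exp v * exp u = exp (u + v)" by (simp add: exp_add)
      moreover have "S (exp (u + v)) > 0" "S (exp u) > 0" using elim by (auto intro!: pos)
      moreover have "max 0 u = u" "max 0 (u + v) = u + v" using elim by auto
      ultimately show ?case by (simp add: h_def ln_div)
    qed
    ultimately show ?thesis by (simp cong: filterlim_cong add: tendsto_cong)
  qed
  obtain A where "A \<ge> 0"
    and A: "\<And>u w. u \<ge> 0 \<Longrightarrow> w \<ge> 0 \<Longrightarrow> \<bar>h w - h u\<bar> \<le> A + \<delta> * \<bar>w - u\<bar>"
    using additive_potter_bound[OF conth limh \<open>\<delta> > 0\<close>] by blast
  have "S y \<le> exp A * max (y / x) (x / y) powr \<delta> * S x" if "x \<ge> 1" "y \<ge> 1" for x y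
  proof -
    have Sx: "S x > 0" "S y > 0" using pos that by auto
    have "ln (S y) - ln (S x) \<le> A + \<delta> * \<bar>ln y - ln x\<bar>"
      using A[of "ln x" "ln y"] that by (simp add: h_def)
    also have "\<bar>ln y - ln x\<bar> = ln (max (y / x) (x / y))"
    proof (cases "x \<le> y")
      case True
      then have "x / y \<le> y / x" using that by (simp add: field_simps mult_mono)
      then show ?thesis using that True by (simp add: ln_div max_def)
    next
      case False
      then have "y / x \<le> x / y" using that by (simp add: field_simps mult_mono)
      then show ?thesis using that False by (simp add: ln_div max_absorb2)
    qed
    finally have "ln (S y) \<le> (A + \<delta> * ln (max (y / x) (x / y))) + ln (S x)" by simp
    then have "exp (ln (S y)) \<le> exp ((A + \<delta> * ln (max (y / x) (x / y))) + ln (S x))" by simp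
    moreover have "max (y / x) (x / y) > 0" using that by (simp add: less_max_iff_disj)
    ultimately show ?thesis using Sx by (simp add: exp_add powr_def)
  qed
  then show ?thesis using \<open>A \<ge> 0\<close> by (intro exI[of _ "exp A"]) auto
qed

section \<open>Elementary growth and summation estimates\<close>

text \<open>This is \<open>1 + y \<le> exp y\<close> at \<open>y = (r / a) * z\<close>, raised to
  the power \<open>a\<close>; the factor \<open>D\<close> makes up for a slope \<open>r / a\<close>
  below 1.\<close>

lemma one_plus_powr_le_exp:
  fixes a r :: real
  assumes "a > 0" "r > 0"
  shows "\<exists>C\<ge>1. \<forall>z\<ge>0. (1 + z) powr a \<le> C * exp (r * z)"
proof (intro exI conjI allI impI)
  define D where "D = max 1 (a / r)"
  show "D powr a \<ge> 1" using assms by (simp add: D_def ge_one_powr_ge_zero)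
  fix z :: real assume "z \<ge> 0"
  have "z = (a / r) * ((r / a) * z)" using assms by simp
  also have "\<dots> \<le> D * ((r / a) * z)" using assms \<open>z \<ge> 0\<close> by (intro mult_right_mono) (auto simp: D_def)
  finally have "1 + z \<le> D * (1 + (r / a) * z)" by (simp add: D_def algebra_simps)
  also have "\<dots> \<le> D * exp ((r / a) * z)"
    by (intro mult_left_mono) (auto simp: D_def exp_ge_add_one_self)
  finally have "(1 + z) powr a \<le> (D * exp ((r / a) * z)) powr a"
    using \<open>z \<ge> 0\<close> assms by (intro powr_mono2) auto
  also have "\<dots> = D powr a * exp (r * z)"
    using assms by (subst powr_mult) (auto simp: D_def exp_powr_real)
  finally show "(1 + z) powr a \<le> D powr a * exp (r * z)" .
qed


text \<open>After division by \<open>x\<close> this is a right-endpoint Riemann sum, with mesh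
  \<open>1 / x\<close>, of the decreasing function
  \<open>1 / (sqrt z * (1 + sqrt z)\<^sup>2)\<close>. Its antiderivative
  \<open>2 * sqrt z / (1 + sqrt z)\<close> stays below 2; \<open>G\<close> is half of it at the
  nodes.\<close>

lemma sum_inverse_sqrt_telescope:
  fixes x :: real
  assumes "x > 0"
  shows "(\<Sum>k<n. 1 / (sqrt (real (Suc k) / x) * (1 + sqrt (real (Suc k) / x))\<^sup>2)) \<le> 2 * x"
proof -
  define r where "r k = sqrt (real k / x)" for k
  define G where "G k = r k / (1 + r k)" for k
  have r0: "r k \<ge> 0" for k using assms by (simp add: r_def)
  have step: "1 / (r (Suc k) * (1 + r (Suc k))\<^sup>2) \<le> 2 * x * (G (Suc k) - G k)" for k
  proof -
    define a b where "a = r k" and "b = r (Suc k)"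
    have a: "a \<ge> 0" by (simp add: a_def r0)
    have ab: "a < b" unfolding a_def b_def r_def using assms by (simp add: divide_strict_right_mono)
    \<comment> \<open>The squares of \<open>a\<close> and \<open>b\<close> are neighbouring nodes,
      so this is the mesh width.\<close>
    have "b\<^sup>2 - a\<^sup>2 = 1 / x"
      unfolding a_def b_def r_def using assms by (simp add: field_simps)
    then have "x * ((b - a) * (a + b)) = 1" using assms by (simp add: power2_eq_square field_simps)
    then have x: "x * (b - a) = 1 / (a + b)" using a ab by (simp add: field_simps)
    have "(a + b) * ((1 + a) * (1 + b)) \<le> (2 * b) * ((1 + b) * (1 + b))"
      using a ab by (intro mult_mono) auto
    then have "2 / ((2 * b) * ((1 + b) * (1 + b))) \<le> 2 / ((a + b) * ((1 + a) * (1 + b)))"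
      using a ab by (intro divide_left_mono mult_pos_pos) auto
    moreover have "2 / ((2 * b) * ((1 + b) * (1 + b))) = 1 / (b * (1 + b)\<^sup>2)"
      by (simp add: power2_eq_square)
    moreover have "2 * x * (b / (1 + b) - a / (1 + a)) = 2 * (x * (b - a)) / ((1 + a) * (1 + b))"
      using a ab by (simp add: field_simps)
    ultimately show ?thesis
      using x by (simp add: G_def a_def[symmetric] b_def[symmetric])
  qed
  have "(\<Sum>k<n. 1 / (r (Suc k) * (1 + r (Suc k))\<^sup>2)) \<le> (\<Sum>k<n. 2 * x * (G (Suc k) - G k))"
    by (intro sum_mono step)
  also have "\<dots> = 2 * x * (G n - G 0)"
    by (simp add: sum_distrib_left[symmetric] sum_lessThan_telescope)
  also have "\<dots> \<le> 2 * x * 1"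
  proof -
    have "G n \<le> 1" using r0[of n] by (simp add: G_def divide_le_eq_1)
    moreover have "G 0 = 0" by (simp add: G_def r_def)
    ultimately show ?thesis using assms by (intro mult_left_mono) auto
  qed
  finally show ?thesis by (simp add: r_def)
qed

section \<open>Reductions for embeddings and moments\<close>

lemma continuously_embeddedI:
  assumes "C \<ge> 0"
    and "\<And>f. f \<in> borel_measurable M \<Longrightarrow> N2 f \<le> ennreal C * N1 f"
  shows "continuously_embedded M N1 N2"
proof -
  have "ennreal C * N1 f < \<top>" if "N1 f < \<top>" for f
    using that by (simp add: ennreal_mult_less_top)
  then have "fun_space M N1 \<subseteq> fun_space M N2"
    using assms(2) unfolding fun_space_def by (blast intro: le_less_trans)
  then show ?thesis using assms unfolding continuously_embedded_def fun_space_def by blast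
qed

text \<open>Serves both embeddings: the norm on the right is an infimum over admissible scales, so
  one estimate per scale suffices. If no scale is admissible, the right-hand side is
  infinite.\<close>

lemma le_mult_INF_ennreal:
  fixes y :: ennreal
  assumes "K > 0" and le: "\<And>u. u \<in> A \<Longrightarrow> y \<le> ennreal (K * u)"
    and pos: "\<And>u. u \<in> A \<Longrightarrow> u > 0"
  shows "y \<le> ennreal K * (INF u\<in>A. ennreal u)"
proof -
  have "y / ennreal K \<le> (INF u\<in>A. ennreal u)"
  proof (rule INF_greatest)
    fix u assume "u \<in> A"
    have "y / ennreal K \<le> ennreal (K * u) / ennreal K"
      by (intro divide_right_mono_ennreal le pos \<open>u \<in> A\<close>)
    also have "\<dots> = ennreal u"
      using \<open>K > 0\<close> pos[OF \<open>u \<in> A\<close>] by (simp add: divide_ennreal)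
    finally show "y / ennreal K \<le> ennreal u" .
  qed
  then have "ennreal K * (y / ennreal K) \<le> ennreal K * (INF u\<in>A. ennreal u)"
    by (rule mult_left_mono) simp
  moreover have "ennreal K * (y / ennreal K) = y"
    using \<open>K > 0\<close> by (simp add: ennreal_times_divide mult.commute[of _ y] ennreal_mult_divide_eq)
  ultimately show ?thesis by simp
qed

text \<open>The range of \<open>\<bar>f\<bar>\<close> is cut at the levels
  \<open>c * exp (k + 1)\<close>. On each layer the integrand is at most its value at the upper end,
  while the measure is at most the tail at the lower end; the first summand covers the values below
  \<open>c * exp 1\<close>.\<close>

lemma moment_le_tail_series:
  assumes "prob_space M" and [measurable]: "f \<in> borel_measurable M" and "c > 0" and "p \<ge> 0"
  shows "(\<integral>\<^sup>+x. ennreal (\<bar>f x\<bar> powr p) \<partial>M) \<le> ennreal ((c * exp 1) powr p) +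
    (\<Sum>k. ennreal ((c * exp (real k + 2)) powr p * tail_fun M f (c * exp (real k + 1))))"
proof -
  interpret prob_space M by fact
  define E where "E k = {x \<in> space M. \<bar>f x\<bar> \<ge> c * exp (real k + 1)}" for k
  have [measurable]: "E k \<in> sets M" for k unfolding E_def by measurable
  define g where "g k x = ennreal ((c * exp (real k + 2)) powr p) * indicator (E k) x" for k x
  have [measurable]: "g k \<in> borel_measurable M" for k unfolding g_def by measurable
  have pointwise: "ennreal (\<bar>f x\<bar> powr p) \<le> ennreal ((c * exp 1) powr p) + (\<Sum>k. g k x)"
    if x: "x \<in> space M" for x
  proof (cases "\<bar>f x\<bar> < c * exp 1")
    case True
    then have "\<bar>f x\<bar> powr p \<le> (c * exp 1) powr p" using assms by (intro powr_mono2) auto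
    then show ?thesis by (simp add: add_increasing2 ennreal_leI)
  next
    case False
    define y where "y = ln (\<bar>f x\<bar> / c)"
    have fpos: "\<bar>f x\<bar> > 0" using False assms by (smt (verit) mult_pos_pos exp_gt_zero)
    have fx: "\<bar>f x\<bar> = c * exp y" using fpos assms by (simp add: y_def)
    have y1: "y \<ge> 1" using False assms by (simp add: fx)
    \<comment> \<open>Since \<open>y \<ge> 1\<close>, the integer under \<open>nat\<close> is
      nonnegative and \<open>y\<close> lies between \<open>k + 1\<close> and
      \<open>k + 2\<close>.\<close>
    define k where "k = nat (\<lfloor>y\<rfloor> - 1)"
    have k: "real k + 1 \<le> y" "y \<le> real k + 2"
      using y1 by (auto simp: k_def of_nat_nat le_floor_iff) linarith+
    have "x \<in> E k" using x k assms by (simp add: E_def fx)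
    moreover have "\<bar>f x\<bar> powr p \<le> (c * exp (real k + 2)) powr p"
      using k assms by (intro powr_mono2) (auto simp: fx)
    ultimately have "ennreal (\<bar>f x\<bar> powr p) \<le> g k x" by (simp add: g_def ennreal_leI)
    also have "\<dots> \<le> (\<Sum>k. g k x)"
      using sum_le_suminf[of "\<lambda>k. g k x" "{k}"] by simp
    finally show ?thesis by (simp add: add_increasing)
  qed
  have "(\<integral>\<^sup>+x. ennreal (\<bar>f x\<bar> powr p) \<partial>M)
      \<le> (\<integral>\<^sup>+x. ennreal ((c * exp 1) powr p) + (\<Sum>k. g k x) \<partial>M)"
    by (intro nn_integral_mono pointwise)
  also have "\<dots> = ennreal ((c * exp 1) powr p) + (\<Sum>k. \<integral>\<^sup>+x. g k x \<partial>M)"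
    by (simp add: nn_integral_add nn_integral_suminf emeasure_space_1)
  also have "(\<lambda>k. \<integral>\<^sup>+x. g k x \<partial>M) =
      (\<lambda>k. ennreal ((c * exp (real k + 2)) powr p * tail_fun M f (c * exp (real k + 1))))"
    by (simp add: g_def nn_integral_cmult_indicator emeasure_eq_measure E_def tail_fun_def
        ennreal_mult' fun_eq_iff)
  finally show ?thesis .
qed

section \<open>The Young-type function and the first embedding\<close>

context
  fixes p0 \<Delta> :: real and S :: "real \<Rightarrow> real"
  assumes p0: "p0 > 1" and \<Delta>: "\<Delta> \<ge> 0"
    and S_pos: "\<And>x. x \<ge> 1 \<Longrightarrow> S x > 0"
    and S_cont: "continuous_on {1..} S"
    and S_slow: "slowly_varying S"
begin

lemma Phi_fun_exp:
  "x \<ge> 1 \<Longrightarrow> Phi_fun p0 \<Delta> S (exp x) = exp (p0 * x) * x powr (- \<Delta>) / S x"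
  by (simp add: Phi_fun_def exp_powr_real mult.commute)

lemma Phi_fun_pos: "u > 0 \<Longrightarrow> Phi_fun p0 \<Delta> S u > 0"
proof (cases "u \<ge> exp 1")
  case True
  assume "u > 0"
  have "ln u \<ge> 1" using True \<open>u > 0\<close> by (simp add: ln_ge_iff)
  then show ?thesis using Phi_fun_exp[of "ln u"] S_pos[of "ln u"] \<open>u > 0\<close>
    by (auto intro!: divide_pos_pos mult_pos_pos)
qed (use S_pos[of 1] in \<open>simp add: Phi_fun_def\<close>)

text \<open>At \<open>exp x\<close>, dividing \<Phi> by its argument leaves
  \<open>exp ((p0 - 1) * x)\<close> times a power of \<open>x\<close> over \<open>S x\<close>. By
  Potter's bound the last two factors vary at most polynomially in \<open>y / x\<close>, and the
  exponential absorbs this because \<open>p0 > 1\<close>. Below \<open>exp 1\<close> the function is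
  quadratic.\<close>

lemma Phi_fun_quasi_increasing:
  "\<exists>K\<ge>1. \<forall>s>0. \<forall>t\<ge>s. Phi_fun p0 \<Delta> S s * t \<le> K * (Phi_fun p0 \<Delta> S t * s)"
proof -
  let ?\<Phi> = "Phi_fun p0 \<Delta> S"
  obtain A where "A \<ge> 1"
    and A: "\<And>x y. x \<ge> 1 \<Longrightarrow> y \<ge> 1 \<Longrightarrow> S y \<le> A * max (y / x) (x / y) powr 1 * S x"
    using potter_bound[OF S_pos S_cont S_slow, of 1] by auto
  obtain C where "C \<ge> 1"
    and C: "\<And>z. z \<ge> 0 \<Longrightarrow> (1 + z) powr (\<Delta> + 1) \<le> C * exp ((p0 - 1) * z)"
    using one_plus_powr_le_exp[of "\<Delta> + 1" "p0 - 1"] p0 \<Delta> by auto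
  have large: "?\<Phi> (exp x) * exp y \<le> (A * C) * (?\<Phi> (exp y) * exp x)" if "1 \<le> x" "x \<le> y" for x y
  proof -
    have pos: "x > 0" "y > 0" "S x > 0" "S y > 0" using that S_pos by auto
    have "x / y \<le> y / x" using that by (simp add: field_simps mult_mono)
    then have Sy: "S y \<le> A * (y / x) * S x"
      using A[of x y] that by (simp add: max_def split: if_splits)
    have ratio: "(y / x) powr (\<Delta> + 1) \<le> C * exp ((p0 - 1) * (y - x))"
    proof -
      \<comment> \<open>As \<open>x \<ge> 1\<close>, the ratio \<open>y / x\<close> is controlled by
        the difference \<open>y - x\<close>, the quantity in the exponential.\<close>
      have "y - x \<le> x * (y - x)" using that by (simp add: mult_le_cancel_right1)
      then have "y / x \<le> 1 + (y - x)" using pos by (simp add: field_simps)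
      then have "(y / x) powr (\<Delta> + 1) \<le> (1 + (y - x)) powr (\<Delta> + 1)"
        using pos \<Delta> by (intro powr_mono2) auto
      also have "\<dots> \<le> C * exp ((p0 - 1) * (y - x))" using that by (intro C) simp
      finally show ?thesis .
    qed
    have split: "x powr (- \<Delta>) = (y / x) powr \<Delta> * y powr (- \<Delta>)"
      using pos by (simp add: powr_divide powr_minus field_simps)
    have "exp (p0 * x + y) * x powr (- \<Delta>) * S y
        \<le> exp (p0 * x + y) * x powr (- \<Delta>) * (A * (y / x) * S x)"
      by (intro mult_left_mono Sy) simp
    also have "\<dots> = (exp (p0 * x + y) * A * y powr (- \<Delta>) * S x) * (y / x) powr (\<Delta> + 1)"
      using pos by (simp add: split powr_add)
    also have "\<dots> \<le> (exp (p0 * x + y) * A * y powr (- \<Delta>) * S x) * (C * exp ((p0 - 1) * (y - x)))"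
      using pos \<open>A \<ge> 1\<close> by (intro mult_left_mono ratio) auto
    also have "\<dots> = A * C * (exp (p0 * x + y) * exp ((p0 - 1) * (y - x))) * y powr (- \<Delta>) * S x"
      by simp
    also have "exp (p0 * x + y) * exp ((p0 - 1) * (y - x)) = exp (p0 * y + x)"
      by (simp add: exp_add[symmetric] algebra_simps)
    finally show ?thesis using pos that by (simp add: Phi_fun_exp exp_add field_simps)
  qed
  have small: "?\<Phi> s * t \<le> ?\<Phi> t * s" if "0 < s" "s \<le> t" "t \<le> exp 1" for s t
  proof -
    \<comment> \<open>The choice of the coefficient makes both branches agree at
      \<open>exp 1\<close>, so the quadratic formula extends to the endpoint.\<close>
    have quad: "?\<Phi> u = (exp p0 / S 1 / (exp 1)\<^sup>2) * u\<^sup>2" if "0 < u" "u \<le> exp 1" for u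
    proof (cases "u = exp 1")
      case True
      then show ?thesis using Phi_fun_exp[of 1] by simp
    qed (use that in \<open>simp add: Phi_fun_def\<close>)
    have "s\<^sup>2 * t \<le> t\<^sup>2 * s" using that by (simp add: power2_eq_square)
    then have "(exp p0 / S 1 / (exp 1)\<^sup>2) * (s\<^sup>2 * t) \<le> (exp p0 / S 1 / (exp 1)\<^sup>2) * (t\<^sup>2 * s)"
      using S_pos[of 1] by (intro mult_left_mono) auto
    then show ?thesis using that by (simp add: quad mult.assoc)
  qed
  define K where "K = A * C"
  have K: "K \<ge> 1" unfolding K_def using \<open>A \<ge> 1\<close> \<open>C \<ge> 1\<close> by (metis mult_mono' mult_1 zero_le_one)
  have "?\<Phi> s * t \<le> K * (?\<Phi> t * s)" if s: "0 < s" and st: "s \<le> t" for s t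
  proof -
    have nonneg: "?\<Phi> t * s \<ge> 0" using that Phi_fun_pos[of t] by simp
    consider "t \<le> exp 1" | "exp 1 \<le> s" | "s < exp 1" "exp 1 < t" by linarith
    then show ?thesis
    proof cases
      case 1
      then have "?\<Phi> s * t \<le> 1 * (?\<Phi> t * s)" using small that by simp
      also have "\<dots> \<le> K * (?\<Phi> t * s)" using K nonneg by (rule mult_right_mono)
      finally show ?thesis .
    next
      case 2
      then have "ln s \<ge> 1" using s by (simp add: ln_ge_iff)
      then show ?thesis using large[of "ln s" "ln t"] that by (simp add: K_def)
    next
      \<comment> \<open>The two regimes are joined by comparing both points with
        \<open>exp 1\<close>; only the upper one contributes a factor \<open>K\<close>.\<close>
      case 3
      have "ln t \<ge> 1" using 3 that by (simp add: ln_ge_iff)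
      then have "?\<Phi> (exp 1) * t \<le> K * (?\<Phi> t * exp 1)"
        using large[of 1 "ln t"] that by (simp add: K_def)
      then have "s * (?\<Phi> (exp 1) * t) \<le> s * (K * (?\<Phi> t * exp 1))"
        using s by (intro mult_left_mono) auto
      moreover have "t * (?\<Phi> s * exp 1) \<le> t * (?\<Phi> (exp 1) * s)"
        using small[of s "exp 1"] 3 that by (intro mult_left_mono) auto
      ultimately have "(?\<Phi> s * t) * exp 1 \<le> (K * (?\<Phi> t * s)) * exp 1"
        by (simp only: ac_simps)
      then show ?thesis by (rule mult_right_le_imp_le) simp
    qed
  qed
  then show ?thesis using K by blast
qed

text \<open>Growth of order one of \<open>\<Phi>\<close>, up to the factor \<open>K\<close>, gives
  \<open>\<Phi> (t / (K u)) \<le> \<Phi> (\<bar>f x\<bar> / u)\<close> on \<open>{\<bar>f\<bar> \<ge> t}\<close>: dilating by \<open>K\<close> absorbs the lack of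
  monotonicity, and Chebyshev's inequality applies.\<close>

lemma Orlicz_embedded_weak_Orlicz:
  assumes "prob_space M"
  shows "continuously_embedded M
    (Orlicz_norm M (Phi_fun p0 \<Delta> S)) (weak_Orlicz_norm M (Phi_fun p0 \<Delta> S))"
proof -
  interpret prob_space M by fact
  let ?\<Phi> = "Phi_fun p0 \<Delta> S"
  obtain K where "K \<ge> 1"
    and K: "\<And>s t. s > 0 \<Longrightarrow> s \<le> t \<Longrightarrow> ?\<Phi> s * t \<le> K * (?\<Phi> t * s)"
    using Phi_fun_quasi_increasing by blast
  show ?thesis
  proof (rule continuously_embeddedI)
    show "K \<ge> 0" using \<open>K \<ge> 1\<close> by simp
    fix f :: "'a \<Rightarrow> real" assume [measurable]: "f \<in> borel_measurable M"
    show "weak_Orlicz_norm M ?\<Phi> f \<le> ennreal K * Orlicz_norm M ?\<Phi> f"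
      unfolding Orlicz_norm_def
    proof (rule le_mult_INF_ennreal)
      fix u assume "u \<in> {u. u > 0 \<and> (\<integral>\<^sup>+x. ennreal (?\<Phi> (\<bar>f x\<bar> / u)) \<partial>M) \<le> 1}"
      then have u: "u > 0" and int: "(\<integral>\<^sup>+x. ennreal (?\<Phi> (\<bar>f x\<bar> / u)) \<partial>M) \<le> 1" by auto
      have "ennreal (?\<Phi> (t / (K * u)) * tail_fun M f t) \<le> 1" if t: "t > 0" for t
      proof -
        define E where "E = {x \<in> space M. \<bar>f x\<bar> \<ge> t}"
        have [measurable]: "E \<in> sets M" unfolding E_def by measurable
        have "?\<Phi> (t / (K * u)) \<le> ?\<Phi> (\<bar>f x\<bar> / u)" if "x \<in> E" for x
        proof -
          define s v where "s = t / (K * u)" and "v = \<bar>f x\<bar> / u"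
          have s: "s > 0" using t u \<open>K \<ge> 1\<close> by (simp add: s_def)
          have Ks: "K * s = t / u" using \<open>K \<ge> 1\<close> by (simp add: s_def)
          have "t / u \<le> v" using that u by (simp add: v_def E_def divide_right_mono)
          then have Ksv: "K * s \<le> v" using Ks by simp
          moreover have "1 * s \<le> K * s" using \<open>K \<ge> 1\<close> s by (intro mult_right_mono) auto
          ultimately have sv: "s \<le> v" by simp
          have "?\<Phi> s * v \<le> ?\<Phi> v * (K * s)" using K[OF s sv] by (simp add: ac_simps)
          also have "\<dots> \<le> ?\<Phi> v * v"
            using Ksv Phi_fun_pos[of v] s sv by (intro mult_left_mono) auto
          finally have "?\<Phi> s \<le> ?\<Phi> v" using s sv by (simp add: mult_le_cancel_right)
          then show ?thesis by (simp add: s_def v_def)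
        qed
        then have le: "ennreal (?\<Phi> (t / (K * u))) * indicator E x \<le> ennreal (?\<Phi> (\<bar>f x\<bar> / u))" for x
          by (auto simp: indicator_def ennreal_leI)
        have "?\<Phi> (t / (K * u)) > 0" using t u \<open>K \<ge> 1\<close> by (intro Phi_fun_pos) simp
        then have "ennreal (?\<Phi> (t / (K * u)) * tail_fun M f t)
            = (\<integral>\<^sup>+x. ennreal (?\<Phi> (t / (K * u))) * indicator E x \<partial>M)"
          by (simp add: nn_integral_cmult_indicator emeasure_eq_measure E_def tail_fun_def ennreal_mult')
        also have "\<dots> \<le> (\<integral>\<^sup>+x. ennreal (?\<Phi> (\<bar>f x\<bar> / u)) \<partial>M)"
          by (intro nn_integral_mono le)
        finally show ?thesis using int by (rule order_trans)
      qed
      then show "weak_Orlicz_norm M ?\<Phi> f \<le> ennreal (K * u)"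
        unfolding weak_Orlicz_norm_def using u \<open>K \<ge> 1\<close>
        by (intro INF_lower) (auto intro!: SUP_least)
    qed (use \<open>K \<ge> 1\<close> in auto)
  qed
qed

section \<open>Moment sums and the second embedding\<close>

text \<open>With \<open>z = (k + 1) / x\<close>, each term is at most
  \<open>x powr \<Delta> * S x\<close> times an integrable profile in \<open>z\<close>, and summing
  over mesh \<open>1 / x\<close> supplies one more factor \<open>x\<close>. Potter's exponent 1/2
  leaves only an integrable singularity \<open>1 / sqrt z\<close> at 0.\<close>

lemma weighted_sum_bound:
  "\<exists>C>0. \<forall>x\<ge>1. \<forall>n.
    1 + (\<Sum>k<n. exp (- (real (Suc k) / x)) * real (Suc k) powr \<Delta> * S (real (Suc k)))
      \<le> C * (x powr (\<Delta> + 1) * S x)"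
proof -
  obtain A where "A \<ge> 1"
    and A: "\<And>x y. x \<ge> 1 \<Longrightarrow> y \<ge> 1 \<Longrightarrow> S y \<le> A * max (y / x) (x / y) powr (1 / 2) * S x"
    using potter_bound[OF S_pos S_cont S_slow, of "1 / 2"] by auto
  obtain C where "C \<ge> 1"
    and C: "\<And>z. z \<ge> 0 \<Longrightarrow> (1 + z) powr (\<Delta> + 2) \<le> C * exp (1 * z)"
    using one_plus_powr_le_exp[of "\<Delta> + 2" 1] \<Delta> by auto
  have main: "1 + (\<Sum>k<n. exp (- (real (Suc k) / x)) * real (Suc k) powr \<Delta> * S (real (Suc k)))
      \<le> (A / S 1 + 4 * A * C) * (x powr (\<Delta> + 1) * S x)" if x: "x \<ge> 1" for x n
  proof -
    have Sx: "S x > 0" using S_pos x .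
    have term_le: "exp (- (real (Suc k) / x)) * real (Suc k) powr \<Delta> * S (real (Suc k))
        \<le> (2 * A * C * x powr \<Delta> * S x) *
          (1 / (sqrt (real (Suc k) / x) * (1 + sqrt (real (Suc k) / x))\<^sup>2))" for k
    proof -
      define z b where "z = real (Suc k) / x" and "b = sqrt z"
      have z: "z > 0" using x by (simp add: z_def)
      have b: "b > 0" "b\<^sup>2 = z" using z by (auto simp: b_def)
      have kz: "real (Suc k) = z * x" using x by (simp add: z_def)
      have root: "max z (1 / z) powr (1 / 2) \<le> (1 + z) / b"
      proof -
        have "((1 + z) / b)\<^sup>2 = (1 + z)\<^sup>2 / z" by (simp add: power_divide b)
        moreover have "max z (1 / z) \<le> (1 + z)\<^sup>2 / z"
          using z by (auto simp: field_simps power2_eq_square)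
        ultimately have "max z (1 / z) \<le> ((1 + z) / b)\<^sup>2" by simp
        then have "sqrt (max z (1 / z)) \<le> (1 + z) / b"
          using z b by (intro real_le_lsqrt) auto
        then show ?thesis using z by (simp add: powr_half_sqrt le_max_iff_disj)
      qed
      have "S (real (Suc k)) \<le> A * max z (1 / z) powr (1 / 2) * S x"
        using A[of x "real (Suc k)"] x by (simp add: z_def)
      also have "\<dots> \<le> A * ((1 + z) / b) * S x"
        using Sx \<open>A \<ge> 1\<close> by (intro mult_right_mono mult_left_mono root) auto
      finally have Sk: "S (real (Suc k)) \<le> A * ((1 + z) / b) * S x" .
      have kpow: "real (Suc k) powr \<Delta> \<le> (1 + z) powr \<Delta> * x powr \<Delta>"
        unfolding kz using z x \<Delta> by (auto simp: powr_mult intro!: mult_right_mono powr_mono2)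
      \<comment> \<open>One more factor \<open>1 + z\<close>, to be absorbed by
        \<open>exp (- z)\<close>, turns \<open>1 / b\<close> into the profile whose sum telescopes;
        hence the exponent \<open>\<Delta> + 2\<close> in the choice of \<open>C\<close>.\<close>
      have "(1 + b)\<^sup>2 \<le> 2 * (1 + z)"
        using b sum_squares_bound[of 1 b] by (simp add: power2_sum)
      then have "1 / b \<le> 2 * (1 + z) * (1 / (b * (1 + b)\<^sup>2))"
        using b by (simp add: field_simps)
      then have binv: "(1 + z) powr (\<Delta> + 1) * (1 / b)
          \<le> (1 + z) powr (\<Delta> + 1) * (2 * (1 + z) * (1 / (b * (1 + b)\<^sup>2)))"
        by (intro mult_left_mono) auto
      have "exp (- z) * real (Suc k) powr \<Delta> * S (real (Suc k))
          \<le> exp (- z) * ((1 + z) powr \<Delta> * x powr \<Delta>) * (A * ((1 + z) / b) * S x)"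
        by (intro mult_mono kpow Sk order_refl) (use S_pos[of "real (Suc k)"] in auto)
      also have "\<dots> = (exp (- z) * x powr \<Delta> * A * S x) * ((1 + z) powr (\<Delta> + 1) * (1 / b))"
        using z by (simp add: powr_add)
      also have "\<dots> \<le> (exp (- z) * x powr \<Delta> * A * S x) *
          ((1 + z) powr (\<Delta> + 1) * (2 * (1 + z) * (1 / (b * (1 + b)\<^sup>2))))"
        using Sx \<open>A \<ge> 1\<close> by (intro mult_left_mono[OF binv]) auto
      also have "\<dots> = (exp (- z) * (1 + z) powr (\<Delta> + 2)) *
          (2 * A * x powr \<Delta> * S x * (1 / (b * (1 + b)\<^sup>2)))"
      proof -
        have "(1 + z) powr (\<Delta> + 2) = (1 + z) powr (\<Delta> + 1) * (1 + z)"
          using z powr_add[of "1 + z" "\<Delta> + 1" 1] by (simp add: add.assoc)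
        then show ?thesis by simp
      qed
      also have "\<dots> \<le> C * (2 * A * x powr \<Delta> * S x * (1 / (b * (1 + b)\<^sup>2)))"
      proof (rule mult_right_mono)
        show "exp (- z) * (1 + z) powr (\<Delta> + 2) \<le> C"
          using C[of z] z by (simp add: exp_minus field_simps)
      qed (use Sx \<open>A \<ge> 1\<close> b in auto)
      finally show ?thesis by (simp add: z_def b_def mult.assoc mult.left_commute)
    qed
    have "(\<Sum>k<n. exp (- (real (Suc k) / x)) * real (Suc k) powr \<Delta> * S (real (Suc k)))
        \<le> (\<Sum>k<n. (2 * A * C * x powr \<Delta> * S x) *
          (1 / (sqrt (real (Suc k) / x) * (1 + sqrt (real (Suc k) / x))\<^sup>2)))"
      by (intro sum_mono term_le)
    also have "\<dots> \<le> (2 * A * C * x powr \<Delta> * S x) * (2 * x)"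
      unfolding sum_distrib_left[symmetric]
      using Sx \<open>A \<ge> 1\<close> \<open>C \<ge> 1\<close> x by (intro mult_left_mono sum_inverse_sqrt_telescope) auto
    also have "\<dots> = 4 * A * C * (x powr (\<Delta> + 1) * S x)"
      using x by (simp add: powr_add)
    finally have "(\<Sum>k<n. exp (- (real (Suc k) / x)) * real (Suc k) powr \<Delta> * S (real (Suc k)))
        \<le> 4 * A * C * (x powr (\<Delta> + 1) * S x)" .
    \<comment> \<open>Potter's bound between \<open>x\<close> and 1 keeps \<open>S x\<close> from
      decaying faster than a power, so the leading 1 is absorbed too.\<close>
    moreover have "1 \<le> A / S 1 * (x powr (\<Delta> + 1) * S x)"
    proof -
      have "1 / x \<le> x" using x by (simp add: field_simps mult_ge1_I order_trans[of 1 x])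
      then have "S 1 \<le> A * x powr (1 / 2) * S x" using A[of x 1] x by (simp add: max_def)
      also have "\<dots> \<le> A * x powr (\<Delta> + 1) * S x"
        using x \<Delta> Sx \<open>A \<ge> 1\<close> by (intro mult_right_mono mult_left_mono powr_mono) auto
      finally show ?thesis using S_pos[of 1] by (simp add: field_simps)
    qed
    ultimately show ?thesis by (simp add: distrib_right)
  qed
  show ?thesis
    using main S_pos[of 1] \<open>A \<ge> 1\<close> \<open>C \<ge> 1\<close>
    by (intro exI[of _ "A / S 1 + 4 * A * C"]) (auto intro!: add_pos_pos)
qed

text \<open>With \<open>x = p0 / (p0 - p)\<close> the base of the left-hand side is a constant multiple of
  \<open>\<psi> p powr p0\<close>.  Passing from the exponent \<open>1 / p0\<close> to \<open>1 / p\<close> costs only a bounded factor, because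
  \<open>1 / p - 1 / p0 \<le> 1 / x\<close> and the base grows polynomially in \<open>x\<close>.\<close>

lemma powr_le_psi_fun:
  assumes "C > 0"
  shows "\<exists>D>0. \<forall>p\<in>{1..<p0}. (C * ((p0 / (p0 - p)) powr (\<Delta> + 1) * S (p0 / (p0 - p)))) powr (1 / p)
    \<le> D * psi_fun p0 \<Delta> S p"
proof -
  obtain A where "A \<ge> 1"
    and A: "\<And>x y. x \<ge> 1 \<Longrightarrow> y \<ge> 1 \<Longrightarrow> S y \<le> A * max (y / x) (x / y) powr 1 * S x"
    using potter_bound[OF S_pos S_cont S_slow, of 1] by auto
  define B where "B = max 1 (C * A * S 1)"
  define D where "D = (C * p0 powr (\<Delta> + 1)) powr (1 / p0) * (B * exp (\<Delta> + 2))"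
  have "B \<ge> 1" by (simp add: B_def)
  have "(C * ((p0 / (p0 - p)) powr (\<Delta> + 1) * S (p0 / (p0 - p)))) powr (1 / p)
    \<le> D * psi_fun p0 \<Delta> S p" if p: "p \<in> {1..<p0}" for p
  proof -
    define x where "x = p0 / (p0 - p)"
    have x: "x \<ge> 1" using p by (simp add: x_def field_simps)
    have Sx: "S x > 0" using S_pos x .
    have px: "p0 - p = p0 / x" using p by (simp add: x_def)
    define Q where "Q = C * (x powr (\<Delta> + 1) * S x)"
    have Q: "Q > 0" using assms Sx x by (simp add: Q_def)
    define e where "e = 1 / p - 1 / p0"
    have e: "e = 1 / (p * x)" using p p0 by (simp add: e_def x_def field_simps)
    have "x * 1 \<le> x * p" using x p by (intro mult_left_mono) auto
    then have e_le: "e \<le> 1 / x" unfolding e using x p by (intro divide_left_mono) (auto simp: mult.commute)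
    have e0: "e \<ge> 0" using x p by (simp add: e)
    have e1: "e \<le> 1" using e_le x by (smt (verit) divide_le_eq_1)
    have "1 / x \<le> x" using x by (simp add: field_simps mult_ge1_I order_trans[of 1 x])
    \<comment> \<open>Comparison with the base point 1 yields the polynomial growth of
      \<open>Q\<close>; since \<open>e \<le> 1 / x\<close>, the factor \<open>Q powr e\<close> is
      then bounded.\<close>
    then have "S x \<le> A * x * S 1" using A[of 1 x] x by (simp add: max_def split: if_splits)
    then have "Q \<le> C * (x powr (\<Delta> + 1) * (A * x * S 1))"
      unfolding Q_def using assms by (intro mult_left_mono) auto
    also have "\<dots> = (C * A * S 1) * x powr (\<Delta> + 2)"
      using x powr_add[of x "\<Delta> + 1" 1] by (simp add: add.assoc)
    also have "\<dots> \<le> B * x powr (\<Delta> + 2)" by (intro mult_right_mono) (auto simp: B_def)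
    finally have "Q powr e \<le> (B * x powr (\<Delta> + 2)) powr e"
      using Q e0 by (intro powr_mono2) auto
    also have "\<dots> = B powr e * x powr ((\<Delta> + 2) * e)"
      using \<open>B \<ge> 1\<close> x by (simp add: powr_mult powr_powr)
    also have "\<dots> \<le> B * exp (\<Delta> + 2)"
    proof (rule mult_mono)
      show "B powr e \<le> B" using powr_mono[OF e1 \<open>B \<ge> 1\<close>] \<open>B \<ge> 1\<close> by simp
      have "e * ln x \<le> (1 / x) * x"
        using e_le x ln_less_self[of x] by (intro mult_mono) (auto intro: less_imp_le)
      then have "(\<Delta> + 2) * (e * ln x) \<le> (\<Delta> + 2) * 1" using x \<Delta> by (intro mult_left_mono) auto
      then show "x powr ((\<Delta> + 2) * e) \<le> exp (\<Delta> + 2)" using x by (simp add: powr_def mult.assoc)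
    qed (use \<open>B \<ge> 1\<close> in auto)
    finally have Qe: "Q powr e \<le> B * exp (\<Delta> + 2)" .
    have psi: "psi_fun p0 \<Delta> S p = ((x / p0) powr (\<Delta> + 1) * S x) powr (1 / p0)"
    proof -
      have "(p0 - p) powr (- (1 + \<Delta>) / p0) = (x / p0) powr ((1 + \<Delta>) / p0)"
        unfolding px using x p0
        by (simp add: powr_divide powr_minus minus_divide_left[symmetric] del: minus_add_distrib)
      then show ?thesis
        unfolding psi_fun_def x_def[symmetric] using x p0 Sx
        by (simp add: powr_mult powr_powr add.commute)
    qed
    have "Q = (C * p0 powr (\<Delta> + 1)) * ((x / p0) powr (\<Delta> + 1) * S x)"
      using x p0 by (simp add: Q_def powr_divide)
    then have Qp0: "Q powr (1 / p0) = (C * p0 powr (\<Delta> + 1)) powr (1 / p0) * psi_fun p0 \<Delta> S p"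
      using assms Sx by (simp add: psi powr_mult)
    have "Q powr (1 / p) = Q powr (1 / p0) * Q powr e"
      by (simp add: powr_add[symmetric] e_def)
    also have "\<dots> \<le> Q powr (1 / p0) * (B * exp (\<Delta> + 2))"
      by (intro mult_left_mono Qe) simp
    also have "\<dots> = D * psi_fun p0 \<Delta> S p" by (simp add: Qp0 D_def)
    finally show ?thesis by (simp add: Q_def x_def)
  qed
  moreover have "D > 0" using assms p0 \<open>B \<ge> 1\<close> by (simp add: D_def)
  ultimately show ?thesis by blast
qed

text \<open>For each admissible \<open>c\<close>, the weak norm bounds the tail at
  \<open>c * exp y\<close> by the reciprocal of \<open>\<Phi> (exp y)\<close>. Inserted into the
  tail series this gives the weighted sum with \<open>x = p0 / (p0 - p)\<close>, and the
  \<open>p\<close>-th root is compared with \<psi>.\<close>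

lemma weak_Orlicz_embedded_grand_Lebesgue:
  assumes "prob_space M"
  shows "continuously_embedded M
    (weak_Orlicz_norm M (Phi_fun p0 \<Delta> S)) (grand_Lebesgue_norm M p0 (psi_fun p0 \<Delta> S))"
proof -
  interpret prob_space M by fact
  let ?\<Phi> = "Phi_fun p0 \<Delta> S" and ?\<psi> = "psi_fun p0 \<Delta> S"
  define a where "a x k = exp (- (real (Suc k) / x)) * real (Suc k) powr \<Delta> * S (real (Suc k))" for x k
  have a_nonneg: "a x k \<ge> 0" for x k using S_pos[of "real (Suc k)"] by (simp add: a_def)
  obtain C where "C > 0"
    and C: "\<And>x n. x \<ge> 1 \<Longrightarrow> 1 + (\<Sum>k<n. a x k) \<le> C * (x powr (\<Delta> + 1) * S x)"
    using weighted_sum_bound unfolding a_def by blast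
  obtain D where "D > 0"
    and D: "\<And>p. p \<in> {1..<p0} \<Longrightarrow>
      ((exp p0 * C) * ((p0 / (p0 - p)) powr (\<Delta> + 1) * S (p0 / (p0 - p)))) powr (1 / p) \<le> D * ?\<psi> p"
    using powr_le_psi_fun[of "exp p0 * C"] \<open>C > 0\<close> by auto
  show ?thesis
  proof (rule continuously_embeddedI)
    show "D \<ge> 0" using \<open>D > 0\<close> by simp
    fix f :: "'a \<Rightarrow> real" assume f: "f \<in> borel_measurable M"
    show "grand_Lebesgue_norm M p0 ?\<psi> f \<le> ennreal D * weak_Orlicz_norm M ?\<Phi> f"
      unfolding weak_Orlicz_norm_def
    proof (rule le_mult_INF_ennreal)
      fix c assume "c \<in> {c. c > 0 \<and> (SUP t\<in>{0<..}. ennreal (?\<Phi> (t / c) * tail_fun M f t)) \<le> 1}"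
      then have c: "c > 0" and "\<And>t. t > 0 \<Longrightarrow> ennreal (?\<Phi> (t / c) * tail_fun M f t) \<le> 1"
        by (auto simp: SUP_le_iff)
      then have tail: "?\<Phi> (t / c) * tail_fun M f t \<le> 1" if "t > 0" for t
        using that by simp
      have tail_exp: "tail_fun M f (c * exp y) \<le> exp (- p0 * y) * y powr \<Delta> * S y" if "y \<ge> 1" for y
        using tail[of "c * exp y"] c that S_pos[of y]
        by (simp add: Phi_fun_exp powr_minus exp_minus field_simps)
      show "grand_Lebesgue_norm M p0 ?\<psi> f \<le> ennreal (D * c)"
        unfolding grand_Lebesgue_norm_def
      proof (rule SUP_least)
        fix p assume p: "p \<in> {1..<p0}"
        define x where "x = p0 / (p0 - p)"
        have x: "x \<ge> 1" using p by (simp add: x_def field_simps)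
        have Sx: "S x > 0" using S_pos x .
        define R where "R = (c * exp 1) powr p"
        have R: "R \<ge> 0" by (simp add: R_def)
        have term_le: "(c * exp (real k + 2)) powr p * tail_fun M f (c * exp (real k + 1)) \<le> R * a x k" for k
        proof -
          define y where "y = real (Suc k)"
          have y: "y \<ge> 1" by (simp add: y_def)
          \<comment> \<open>The true decay rate is \<open>p0 - p\<close>; since
            \<open>p0 > 1\<close> it may be weakened to \<open>1 / x\<close>, the rate in the
            weighted sum.\<close>
          have "y / x = (p0 - p) * y / p0" by (simp add: x_def)
          also have "\<dots> \<le> (p0 - p) * y / 1" using p p0 y by (intro divide_left_mono) auto
          finally have "y / x \<le> (p0 - p) * y" by simp
          then have "exp (p * y) * exp (- p0 * y) \<le> exp (- (y / x))"
            by (simp add: exp_add[symmetric] algebra_simps)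
          then have decay: "(exp (p * y) * exp (- p0 * y)) * (y powr \<Delta> * S y) \<le> exp (- (y / x)) * (y powr \<Delta> * S y)"
            using S_pos[OF y] by (intro mult_right_mono) auto
          have "(c * exp (y + 1)) powr p = R * exp (p * y)"
            using c by (simp add: R_def powr_mult exp_powr_real exp_add[symmetric] algebra_simps)
          then have "(c * exp (y + 1)) powr p * tail_fun M f (c * exp y)
              \<le> (R * exp (p * y)) * (exp (- p0 * y) * y powr \<Delta> * S y)"
            using tail_exp[OF y] R by (intro mult_mono) (auto simp: tail_fun_def)
          also have "\<dots> = R * ((exp (p * y) * exp (- p0 * y)) * (y powr \<Delta> * S y))" by simp
          also have "\<dots> \<le> R * (exp (- (y / x)) * (y powr \<Delta> * S y))"
            by (intro mult_left_mono decay R)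
          finally show ?thesis by (simp add: y_def a_def mult.assoc add.commute add.left_commute)
        qed
        have "(\<integral>\<^sup>+x. ennreal (\<bar>f x\<bar> powr p) \<partial>M) \<le> ennreal R +
            (\<Sum>k. ennreal ((c * exp (real k + 2)) powr p * tail_fun M f (c * exp (real k + 1))))"
          unfolding R_def using p by (intro moment_le_tail_series assms f c) simp
        also have "\<dots> \<le> ennreal R + (\<Sum>k. ennreal (R * a x k))"
          by (intro add_left_mono suminf_le ennreal_leI term_le) auto
        also have "\<dots> \<le> ennreal (R * (C * (x powr (\<Delta> + 1) * S x)))"
        proof -
          \<comment> \<open>The \<open>- 1\<close> reserves room for the separate summand
            \<open>R\<close>; the case \<open>n = 0\<close> of the bound shows that the difference
            is nonnegative.\<close>
          have "(\<Sum>k<n. ennreal (R * a x k)) \<le> ennreal (R * (C * (x powr (\<Delta> + 1) * S x) - 1))" for n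
            using C[OF x, of n] R a_nonneg
            by (subst sum_ennreal)
              (auto simp: sum_distrib_left[symmetric] intro!: ennreal_leI mult_left_mono)
          then have "(\<Sum>k. ennreal (R * a x k)) \<le> ennreal (R * (C * (x powr (\<Delta> + 1) * S x) - 1))"
            by (intro suminf_le_const) auto
          then have "ennreal R + (\<Sum>k. ennreal (R * a x k))
              \<le> ennreal R + ennreal (R * (C * (x powr (\<Delta> + 1) * S x) - 1))"
            by (rule add_left_mono)
          also have "\<dots> = ennreal (R * (C * (x powr (\<Delta> + 1) * S x)))"
            using R C[OF x, of 0]
            by (subst ennreal_plus[symmetric]) (auto simp: mult_le_cancel_left1 right_diff_distrib)
          finally show ?thesis .
        qed
        also have "\<dots> \<le> ennreal (c powr p * ((exp p0 * C) * (x powr (\<Delta> + 1) * S x)))"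
        proof (rule ennreal_leI)
          have "R = c powr p * exp p" using c by (simp add: R_def powr_mult exp_powr_real)
          \<comment> \<open>Replacing \<open>exp p\<close> by \<open>exp p0\<close> makes the
            constant independent of \<open>p\<close>; \<open>c powr p\<close> is kept, so that the
            \<open>p\<close>-th root returns exactly \<open>c\<close>.\<close>
          also have "\<dots> \<le> c powr p * exp p0" using p by (intro mult_left_mono) auto
          finally have "R * (C * (x powr (\<Delta> + 1) * S x)) \<le> (c powr p * exp p0) * (C * (x powr (\<Delta> + 1) * S x))"
            using \<open>C > 0\<close> Sx by (intro mult_right_mono) auto
          then show "R * (C * (x powr (\<Delta> + 1) * S x)) \<le> c powr p * ((exp p0 * C) * (x powr (\<Delta> + 1) * S x))"
            by (simp add: mult.assoc)
        qed
        finally have moment: "(\<integral>\<^sup>+x. ennreal (\<bar>f x\<bar> powr p) \<partial>M)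
            \<le> ennreal (c powr p * ((exp p0 * C) * (x powr (\<Delta> + 1) * S x)))" (is "?I \<le> ennreal ?J") .
        have J: "?J \<ge> 0" using \<open>C > 0\<close> Sx by simp
        have fin: "?I \<noteq> \<top>" using moment by (auto simp: top_unique)
        have psi_pos: "?\<psi> p > 0"
          unfolding psi_fun_def x_def[symmetric] using Sx p by simp
        have "enn2real ?I powr (1 / p) \<le> ?J powr (1 / p)"
          using moment J p by (intro powr_mono2 enn2real_leI) auto
        also have "\<dots> = c * ((exp p0 * C) * (x powr (\<Delta> + 1) * S x)) powr (1 / p)"
          using c \<open>C > 0\<close> Sx p by (subst powr_mult) (auto simp: powr_powr)
        also have "\<dots> \<le> c * (D * ?\<psi> p)"
          using D[OF p] c by (intro mult_left_mono) (auto simp: x_def)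
        finally have "Lp_norm M p f \<le> ennreal ((D * c) * ?\<psi> p)"
          using fin by (simp add: Lp_norm_def Let_def ennreal_leI ac_simps)
        then have "Lp_norm M p f / ennreal (?\<psi> p) \<le> ennreal ((D * c) * ?\<psi> p) / ennreal (?\<psi> p)"
          by (rule divide_right_mono_ennreal)
        also have "\<dots> = ennreal (D * c)" using psi_pos \<open>D > 0\<close> c by (simp add: divide_ennreal)
        finally show "Lp_norm M p f / ennreal (?\<psi> p) \<le> ennreal (D * c)" .
      qed
    qed (use \<open>D > 0\<close> in auto)
  qed
qed

end

theorem theorem4p1:
  fixes M :: "'a measure" and p0 \<Delta> :: real and S :: "real \<Rightarrow> real"
  assumes "prob_space M"
    and "p0 > 1" and "\<Delta> \<ge> 0"
    and "\<And>x. x \<ge> 1 \<Longrightarrow> S x > 0"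
    and "continuous_on {1..} S"
    and "slowly_varying S"
  shows "continuously_embedded M
           (Orlicz_norm M (Phi_fun p0 \<Delta> S)) (weak_Orlicz_norm M (Phi_fun p0 \<Delta> S))
       \<and> continuously_embedded M
           (weak_Orlicz_norm M (Phi_fun p0 \<Delta> S)) (grand_Lebesgue_norm M p0 (psi_fun p0 \<Delta> S))"
  using Orlicz_embedded_weak_Orlicz[OF assms(2-6,1)]
    weak_Orlicz_embedded_grand_Lebesgue[OF assms(2-6,1)] by blast

end
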